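(* Let $p$ be a prime, let $N$ be a positive integer, let $\lambda$ be a partition of $N$, and let $G_{\lambda}$ be the corresponding abelian $p$-group. Then $$\mathrm{N}(\mathrm{P}(G_{\lambda})) = 1+\frac{1}{2p^{N}}\sum_{t=0}^{N-1}p^{s_{t}(\lambda)}(\beta_{t}-\beta_{t+1}),\qquad \text{where } \beta_{t}:=\binom{2p^{N-t}}{p^{N-t}}\quad (0\le t\le N).$$
   Context: For a finite group $G$, take independent commuting variables $x_g$ ($g\in G$) and let $M(G):=(x_{gh^{-1}})_{g,h\in G}$ be the group matrix. The group permanent is $\mathrm{P}(G):=\mathrm{perm}(M(G))=\sum_{\sigma}\prod_{g\in G}x_{g\sigma(g)^{-1}}\in\mathbb{Z}[x_g : g\in G]$, where $\sigma$ runs over all permutations of the set $G$. For a polynomial $f$, $\mathrm{N}(f)$ denotes the number of distinct monomials with nonzero coefficient in $f$. A partition of $N$ is $\lambda=(k_1,k_2,\ldots,k_r)$ with $k_1\ge k_2\ge\cdots\ge k_r\ge 1$ and $\sum_i k_i=N$. The associated abelian $p$-group is $G_{\lambda}:=\mathrm{C}_{p^{k_1}}\times\mathrm{C}_{p^{k_2}}\times\cdots\times\mathrm{C}_{p^{k_r}}$ (of order $p^N$), where $\mathrm{C}_n$ is the cyclic group of order $n$. Put $s_0(\lambda):=0$ and $s_t(\lambda):=\sum_{i=1}^{r}\min(k_i,t)$ for $t=1,\ldots,N$ (the number of boxes in the first $t$ columns of the Young diagram of $\lambda$). *)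

theory Defs
  imports
    Complex_Main
    "HOL-Library.Poly_Mapping"
    "HOL-Combinatorics.Permutations"
    "HOL-Computational_Algebra.Primes"
    "HOL-Algebra.Elementary_Groups"
    "HOL-Algebra.Product_Groups"
begin

text \<open>
  Integer polynomials in commuting variables indexed by \<open>'g\<close>: monomials are finitely supported
  exponent vectors, a polynomial is a finitely supported map from monomials to coefficients, and
  multiplication is the convolution of \<^theory>\<open>HOL-Library.Poly_Mapping\<close>.
\<close>

type_synonym 'g int_mpoly = "('g \<Rightarrow>\<^sub>0 nat) \<Rightarrow>\<^sub>0 int"

definition mvar :: "'g \<Rightarrow> 'g int_mpoly" where
  "mvar g = Poly_Mapping.single (Poly_Mapping.single g 1) 1"

definition num_monomials :: "'g int_mpoly \<Rightarrow> nat" where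
  "num_monomials f = card (Poly_Mapping.keys f)"

text \<open>The row and column index set is explicit; values of the matrix outside it are irrelevant.\<close>

definition permanent :: "'i set \<Rightarrow> ('i \<Rightarrow> 'i \<Rightarrow> 'r::comm_ring_1) \<Rightarrow> 'r" where
  "permanent A M = (\<Sum>\<sigma> | \<sigma> permutes A. \<Prod>a\<in>A. M a (\<sigma> a))"

definition group_matrix :: "('g, 'm) monoid_scheme \<Rightarrow> 'g \<Rightarrow> 'g \<Rightarrow> 'g int_mpoly" where
  "group_matrix G g h = mvar (g \<otimes>\<^bsub>G\<^esub> inv\<^bsub>G\<^esub> h)"

definition group_permanent :: "('g, 'm) monoid_scheme \<Rightarrow> 'g int_mpoly" where
  "group_permanent G = permanent (carrier G) (group_matrix G)"

definition is_partition :: "nat \<Rightarrow> nat list \<Rightarrow> bool" where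
  "is_partition N ks \<longleftrightarrow> sorted_wrt (\<ge>) ks \<and> (\<forall>k\<in>set ks. k \<ge> 1) \<and> sum_list ks = N"

definition abelian_p_group :: "nat \<Rightarrow> nat list \<Rightarrow> (nat \<Rightarrow> int) monoid" where
  "abelian_p_group p ks =
     product_group {..<length ks} (\<lambda>i. integer_mod_group (p ^ (ks ! i)))"

text \<open>The number of boxes in the first \<open>t\<close> columns of the Young diagram of \<open>ks\<close>;
  in particular it is \<open>0\<close> for \<open>t = 0\<close>.\<close>

definition column_boxes :: "nat list \<Rightarrow> nat \<Rightarrow> nat" where
  "column_boxes ks t = (\<Sum>i<length ks. min (ks ! i) t)"

definition \<beta> :: "nat \<Rightarrow> nat \<Rightarrow> nat \<Rightarrow> nat" where
  "\<beta> p N t = (2 * p ^ (N - t)) choose (p ^ (N - t))"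

lemma column_boxes_0 [simp]: "column_boxes ks 0 = 0"
  by (simp add: column_boxes_def)

lemma group_abelian_p_group: "group (abelian_p_group p ks)"
  unfolding abelian_p_group_def by (rule product_group) simp

lemma order_abelian_p_group:
  assumes "p > 0" "is_partition N ks"
  shows "order (abelian_p_group p ks) = p ^ N"
proof -
  have "order (abelian_p_group p ks) = (\<Prod>i<length ks. p ^ (ks ! i))"
    using assms(1)
    by (simp add: order_def abelian_p_group_def card_PiE carrier_integer_mod_group nat_power_eq)
  also have "\<dots> = p ^ N"
    using assms(2)
    by (simp add: is_partition_def sum_list_sum_nth atLeast0LessThan flip: power_sum)
  finally show ?thesis .
qed

end

theory Submission
  imports Defs "HOL-Algebra.FiniteProduct" "HOL-Computational_Algebra.Formal_Laurent_Series"
begin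

text \<open>
  Every permutation of a finite abelian group of order \<open>n\<close> contributes to the permanent the monomial
  of the multiset of quotients \<open>g \<otimes> inv (\<sigma> g)\<close>, always with coefficient \<open>1\<close>, so nothing cancels and
  the task is to count the multisets that occur. The elements of such a multiset multiply to the
  identity. By a theorem of M. Hall (\<open>hall_difference_theorem\<close>) this is the only restriction: every
  multiset of \<open>n\<close> elements with product \<open>\<one>\<close> occurs. The proof of that theorem changes two quotients
  at a time, keeping their product, and repairs the two enumerations of the group along a path
  (\<open>difference_exchange\<close>).
  
  It remains to count the multisets of size \<open>n\<close> with product \<open>\<one>\<close>. By orthogonality of characters
  their number is \<open>1 / n\<close> times the sum, over all characters \<open>\<chi>\<close>, of the complete homogeneous
  symmetric polynomial of degree \<open>n\<close> in the values of \<open>\<chi>\<close>. A character of order \<open>d\<close> takes each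
  \<open>d\<close>-th root of unity \<open>m = n / d\<close> times, so the generating function of these polynomials is
  \<open>1 / (1 - X ^ d) ^ m\<close>, and the value wanted is \<open>(2 * m - 1) choose m\<close>, half of
  \<open>(2 * m) choose m\<close> (\<open>sum_multisets_character\<close>).
  
  For the group of a partition, the characters are given explicitly by roots of unity, and those of
  order dividing \<open>p ^ t\<close> number \<open>p ^ column_boxes ks t\<close> (\<open>card_pairing_characters_torsion\<close>).
  Characters of order exactly \<open>p ^ t\<close> contribute half of \<open>\<beta> p N t\<close> each, and summation by parts gives
  the formula.
\<close>

section \<open>Prescribed differences of two enumerations of a group\<close>

text \<open>
  Read each \<open>k \<in> J\<close> as an arrow from \<open>f k\<close> to \<open>g k\<close>. Since \<open>g\<close> is injective, following arrows
  from a point \<open>v\<close> that no arrow enters never revisits a point, so the walk ends at a point \<open>w\<close>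
  that no arrow leaves. With \<open>P\<close> the set of arrows used, the tails of \<open>P\<close> are all the visited
  points except \<open>w\<close>, and the heads are all of them except \<open>v\<close>. The induction removes the
  first arrow.
\<close>

lemma alternating_path_exists:
  assumes "finite J" "inj_on g J" "v \<notin> g ` J"
  shows "\<exists>P w. P \<subseteq> J \<and> w \<notin> f ` J \<and> insert w (f ` P) = insert v (g ` P)"
  using assms
proof (induction "card J" arbitrary: J v rule: less_induct)
  case less
  show ?case
  proof (cases "v \<in> f ` J")
    case False
    then show ?thesis by (intro exI[of _ "{}"] exI[of _ v]) auto
  next
    case True
    then obtain i where i: "i \<in> J" "v = f i" by auto
    have "card (J - {i}) < card J"
      using i less.prems by (intro psubset_card_mono) auto
    moreover have "inj_on g (J - {i})" "g i \<notin> g ` (J - {i})"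
      using less.prems i by (auto simp: inj_on_def)
    ultimately obtain P w where Pw: "P \<subseteq> J - {i}" "w \<notin> f ` (J - {i})"
      "insert w (f ` P) = insert (g i) (g ` P)"
      using less.hyps[of "J - {i}" "g i"] less.prems by (metis finite_Diff)
    have "w \<in> g ` J" using Pw i by blast
    then have "w \<noteq> v" using less.prems by auto
    then show ?thesis
      using Pw i by (intro exI[of _ "insert i P"] exI[of _ w]) auto
  qed
qed

context comm_group
begin

text \<open>
  The exchange step of Hall's argument. Write \<open>c k = a k \<otimes> b k\<close>. The reflection
  \<open>T z = K \<otimes> inv z\<close> is an involution, and replacing the pair \<open>(a k, c k)\<close> by
  \<open>(T (c k), T (a k))\<close> leaves the quotient \<open>b k\<close> unchanged, whatever \<open>K\<close> is. Swapping exactly the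
  indices on the walk with arrows from \<open>T (c k)\<close> to \<open>a k\<close> that starts at \<open>a j\<close> exchanges the value
  \<open>a j\<close> for the end point \<open>w\<close>, while every other value is still taken. The choice of \<open>K\<close> makes
  \<open>a i\<close> paired with \<open>T (a j)\<close> have quotient \<open>b' i\<close>. Since the walk stops at \<open>w\<close>, the value \<open>T w\<close> is
  one of \<open>c i\<close>, \<open>c j\<close>; the other of these two is the partner of \<open>w\<close>, with quotient \<open>b' j\<close>.
\<close>

lemma difference_exchange:
  assumes fin: "finite I" and ij: "i \<in> I" "j \<in> I" "i \<noteq> j"
    and b: "b \<in> I \<rightarrow> carrier G" and b': "b' \<in> I \<rightarrow> carrier G"
    and eq: "\<And>k. k \<in> I - {i, j} \<Longrightarrow> b' k = b k"
    and prod_eq: "b' i \<otimes> b' j = b i \<otimes> b j"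
    and a: "bij_betw a I (carrier G)" and ab: "bij_betw (\<lambda>k. a k \<otimes> b k) I (carrier G)"
  shows "\<exists>a'. bij_betw a' I (carrier G) \<and> bij_betw (\<lambda>k. a' k \<otimes> b' k) I (carrier G)"
proof -
  define c where "c k = a k \<otimes> b k" for k
  define K where "K = c i \<otimes> c j \<otimes> inv (b' j)"
  define T where "T z = K \<otimes> inv z" for z
  define J where "J = I - {i, j}"
  have I: "I = insert i (insert j J)" and J: "J \<subseteq> I" "i \<notin> J" "j \<notin> J" using ij by (auto simp: J_def)
  have aG: "a k \<in> carrier G" and cG: "c k \<in> carrier G" and bG: "b k \<in> carrier G" "b' k \<in> carrier G"
    if "k \<in> I" for k
    using a ab b b' that by (auto simp: c_def bij_betw_def)
  have KG: "K \<in> carrier G" using ij aG bG cG by (simp add: K_def)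
  have TG: "T z \<in> carrier G" if "z \<in> carrier G" for z using that KG by (simp add: T_def)
  have T_mult: "T z \<otimes> z = K" if "z \<in> carrier G" for z
    using that KG by (simp add: T_def m_assoc)
  have T_eqI: "T z = u" if "u \<otimes> z = K" "u \<in> carrier G" "z \<in> carrier G" for u z
  proof -
    have "T z \<otimes> z = u \<otimes> z" using that T_mult by simp
    then show ?thesis using that TG right_cancel[of z "T z" u] by simp
  qed
  have TT: "T (T z) = z" if "z \<in> carrier G" for z
    using that TG T_mult by (intro T_eqI) (simp_all add: m_comm)
  have K_mult: "K \<otimes> b' j = c i \<otimes> c j"
    using ij bG cG by (simp add: K_def m_assoc)
  have inj_a: "inj_on a I" and im_a: "a ` I = carrier G" using a by (auto simp: bij_betw_def)
  have im_c: "c ` I = carrier G" using ab by (auto simp: bij_betw_def c_def)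
  have "a j \<notin> a ` J" using inj_a J ij by (auto simp: inj_on_def)
  moreover have "finite J" "inj_on a J" using fin inj_a J by (auto intro: finite_subset inj_on_subset)
  ultimately obtain P w where P: "P \<subseteq> J" and w: "w \<notin> (\<lambda>k. T (c k)) ` J"
    and Pw: "insert w ((\<lambda>k. T (c k)) ` P) = insert (a j) (a ` P)"
    using alternating_path_exists[of J a "a j" "\<lambda>k. T (c k)"] by blast
  have "w \<in> insert (a j) (a ` P)" using Pw by blast
  then have wG: "w \<in> carrier G" using aG ij P J by auto
  define a' where "a' k = (if k = i then a i else if k = j then w else if k \<in> P then T (c k) else a k)" for k
  define c' where "c' k = a' k \<otimes> b' k" for k
  have c'_i: "c' i = T (a j)"
  proof (rule T_eqI[symmetric])
    have "c' i \<otimes> a j \<otimes> b' j = a i \<otimes> a j \<otimes> (b' i \<otimes> b' j)"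
      using aG bG ij by (simp add: c'_def a'_def m_ac)
    also have "\<dots> = c i \<otimes> c j"
      unfolding prod_eq using aG bG ij by (simp add: c_def m_ac)
    finally have "c' i \<otimes> a j \<otimes> b' j = K \<otimes> b' j" by (simp add: K_mult)
    moreover have "c' i \<in> carrier G" using aG bG ij by (simp add: c'_def a'_def)
    ultimately show "c' i \<otimes> a j = K" using aG bG ij KG right_cancel[of "b' j" "c' i \<otimes> a j" K] by simp
  qed (use aG bG ij in \<open>simp_all add: c'_def a'_def\<close>)
  have c'_P: "c' k = T (a k)" if "k \<in> P" for k
  proof (rule T_eqI[symmetric])
    have k: "k \<in> I" "k \<in> J" using that P J by auto
    have c'k: "c' k = T (c k) \<otimes> b k"
      using that k J eq by (auto simp: c'_def a'_def J_def)
    then have "c' k \<otimes> a k = T (c k) \<otimes> c k"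
      using k aG bG cG TG by (simp add: c_def m_ac)
    then show "c' k \<otimes> a k = K" using T_mult cG k by simp
    show "c' k \<in> carrier G" "a k \<in> carrier G" using c'k k aG bG cG TG by simp_all
  qed
  have c'_rest: "c' k = c k" if "k \<in> J - P" for k
    using that J eq by (auto simp: c'_def a'_def c_def J_def)
  have im_a': "a' ` I = carrier G"
  proof -
    have "a' ` I = insert (a i) (insert w ((\<lambda>k. T (c k)) ` P)) \<union> a ` (J - P)"
    proof -
      have "I = insert i (insert j (P \<union> (J - P)))" using I P by auto
      moreover have "a' ` P = (\<lambda>k. T (c k)) ` P" "a' ` (J - P) = a ` (J - P)"
        "a' i = a i" "a' j = w"
        using P J ij by (auto simp: a'_def intro!: image_cong)
      ultimately show ?thesis by (metis Un_insert_left image_Un image_insert)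
    qed
    also have "\<dots> = a ` I"
      unfolding Pw using I P by auto
    finally show ?thesis using im_a by simp
  qed
  have im_c': "c' ` I = carrier G"
  proof -
    have "c' ` I = insert (c' i) (insert (c' j) (c' ` P \<union> c' ` (J - P)))"
      using I P by auto
    also have "c' ` P = T ` a ` P" using c'_P by (auto simp: image_image)
    also have "c' ` (J - P) = c ` (J - P)" using c'_rest by auto
    also have "insert (c' i) (insert (c' j) (T ` a ` P \<union> c ` (J - P))) =
        insert (c' j) (T ` insert (a j) (a ` P) \<union> c ` (J - P))"
      by (auto simp: c'_i)
    also have "\<dots> = insert (c' j) (insert (T w) (T ` (\<lambda>k. T (c k)) ` P) \<union> c ` (J - P))"
      by (simp flip: Pw)
    also have "T ` (\<lambda>k. T (c k)) ` P = c ` P"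
      unfolding image_image
    proof (rule image_cong[OF refl])
      show "T (T (c k)) = c k" if "k \<in> P" for k using that P J cG[of k] TT[of "c k"] by blast
    qed
    also have "insert (c' j) (insert (T w) (c ` P) \<union> c ` (J - P)) = insert (c' j) (insert (T w) (c ` J))"
      using P by auto
    also have "{c' j, T w} = {c i, c j}"
    proof -
      have "T w \<in> c ` I" using im_c TG wG by simp
      then obtain k where k: "k \<in> I" "T w = c k" by auto
      then have "k \<notin> J" using w TT[OF wG] by auto
      then have Tw: "T w = c i \<or> T w = c j" using k I by auto
      have "c' j = w \<otimes> b' j" using ij by (auto simp: c'_def a'_def)
      then have "T w \<otimes> c' j = T w \<otimes> w \<otimes> b' j"
        using wG ij bG TG by (simp add: m_assoc)
      then have "T w \<otimes> c' j = c i \<otimes> c j" using T_mult wG K_mult by simp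
      moreover have "c' j \<in> carrier G" using ij bG wG by (simp add: c'_def a'_def)
      ultimately have "(T w = c i \<and> c' j = c j) \<or> (T w = c j \<and> c' j = c i)"
        using Tw cG[OF ij(1)] cG[OF ij(2)] m_comm[of "c i" "c j"] by (metis Units_eq Units_l_cancel)
      then show ?thesis by auto
    qed
    then have "insert (c' j) (insert (T w) (c ` J)) = insert (c i) (insert (c j) (c ` J))"
      by blast
    also have "\<dots> = c ` I" using I by auto
    finally show ?thesis using im_c by simp
  qed
  have card: "card (carrier G) = card I" using a by (simp add: bij_betw_same_card)
  \<comment> \<open>Between finite sets of equal size, a surjection is a bijection.\<close>
  show ?thesis
    using im_a' im_c' fin card
    by (intro exI[of _ a']) (auto simp: bij_betw_def c'_def[symmetric] intro!: eq_card_imp_inj_on)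
qed

text \<open>
  M. Hall's theorem. For \<open>b\<close> constantly \<open>\<one>\<close>, any enumeration \<open>a\<close> of the group will do. The entries
  are then set to their final values one at a time; a fixed index \<open>i0\<close> absorbs the change, so that
  the product stays \<open>\<one>\<close> and the exchange step applies. At the end the entry at \<open>i0\<close> is forced
  by the product and is therefore the required one.
\<close>

theorem hall_difference_theorem:
  assumes fin: "finite I" and card: "card I = card (carrier G)" and fG: "finite (carrier G)"
    and b: "b \<in> I \<rightarrow> carrier G" and prod1: "finprod G b I = \<one>"
  shows "\<exists>a. bij_betw a I (carrier G) \<and> bij_betw (\<lambda>i. a i \<otimes> b i) I (carrier G)"
proof -
  have "I \<noteq> {}" using card fG one_closed by force
  then obtain i0 where i0: "i0 \<in> I" by blast
  define B where "B J = (\<lambda>i. if i = i0 then inv (finprod G b J) else if i \<in> J then b i else \<one>)" for J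
  have "\<exists>a. bij_betw a I (carrier G) \<and> bij_betw (\<lambda>i. a i \<otimes> B J i) I (carrier G)"
    if "J \<subseteq> I - {i0}" for J
  proof -
    have "finite J" using that fin by (auto intro: finite_subset)
    from this that show ?thesis
    proof (induction J)
      case empty
      obtain a where a: "bij_betw a I (carrier G)"
        using finite_same_card_bij[OF fin fG] card by auto
      then have "a i \<otimes> B {} i = a i" if "i \<in> I" for i
        using that bij_betwE[OF a] by (simp add: B_def)
      then have "bij_betw (\<lambda>i. a i \<otimes> B {} i) I (carrier G)"
        using a by (subst bij_betw_cong[of _ _ a]) auto
      with a show ?case by blast
    next
      case (insert j J)
      then obtain a where a: "bij_betw a I (carrier G)" "bij_betw (\<lambda>i. a i \<otimes> B J i) I (carrier G)"
        by auto
      have bG: "b k \<in> carrier G" if "k \<in> insert j J" for k using that insert.prems b by auto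
      have PG: "finprod G b J \<in> carrier G" using bG by (intro finprod_closed) auto
      have B1: "B J \<in> I \<rightarrow> carrier G" using bG PG by (auto simp: B_def)
      have P': "finprod G b (insert j J) = b j \<otimes> finprod G b J"
        using insert bG by (intro finprod_insert) auto
      show ?case
      proof (rule difference_exchange[OF fin i0, of j "B J" "B (insert j J)"])
        show "B (insert j J) \<in> I \<rightarrow> carrier G" using bG PG P' by (auto simp: B_def)
        show "B (insert j J) i0 \<otimes> B (insert j J) j = B J i0 \<otimes> B J j"
          using insert bG[of j] PG
          by (auto simp: B_def P' inv_mult_group m_assoc)
      qed (use insert a B1 in \<open>auto simp: B_def\<close>)
    qed
  qed
  from this[of "I - {i0}"] obtain a where
    a: "bij_betw a I (carrier G)" "bij_betw (\<lambda>i. a i \<otimes> B (I - {i0}) i) I (carrier G)" by blast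
  have eqb: "B (I - {i0}) i = b i" if "i \<in> I" for i
  proof (cases "i = i0")
    case True
    have "finprod G b I = b i0 \<otimes> finprod G b (I - {i0})"
      using finprod_insert[of "I - {i0}" i0 b] fin b i0 by (auto simp: insert_absorb)
    moreover have "finprod G b (I - {i0}) \<in> carrier G" using b by (intro finprod_closed) auto
    ultimately show ?thesis
      using True prod1 b i0 by (auto simp: B_def intro: inv_equality)
  qed (use that in \<open>auto simp: B_def\<close>)
  then have "bij_betw (\<lambda>i. a i \<otimes> b i) I (carrier G)"
    using a(2) by (subst bij_betw_cong[of _ _ "\<lambda>i. a i \<otimes> B (I - {i0}) i"]) auto
  with a show ?thesis by blast
qed

end

section \<open>The monomials of the group permanent\<close>

definition monomial_of :: "'g multiset \<Rightarrow> 'g \<Rightarrow>\<^sub>0 nat" where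
  "monomial_of X = (\<Sum>g\<in>#X. Poly_Mapping.single g 1)"

lemma lookup_monomial_of: "Poly_Mapping.lookup (monomial_of X) g = count X g"
  by (induction X) (auto simp: monomial_of_def lookup_add lookup_single when_def)

lemma inj_monomial_of: "inj monomial_of"
  by (metis injI lookup_monomial_of multiset_eqI)

lemma prod_single_1:
  "(\<Prod>a\<in>A. Poly_Mapping.single (f a) (1::int)) = Poly_Mapping.single (\<Sum>a\<in>A. f a) 1"
  by (induction A rule: infinite_finite_induct) (auto simp: mult_single)

text \<open>
  All coefficients are positive, so monomials cannot cancel.
\<close>

lemma keys_sum_single_1:
  assumes "finite S"
  shows "Poly_Mapping.keys (\<Sum>s\<in>S. Poly_Mapping.single (f s) (1::int)) = f ` S"
proof -
  have "Poly_Mapping.lookup (\<Sum>s\<in>S. Poly_Mapping.single (f s) (1::int)) m = int (card {s\<in>S. f s = m})" for m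
    using assms by (simp add: lookup_sum lookup_single when_def sum.If_cases Int_def eq_commute[of m])
  then show ?thesis using assms by (auto simp: in_keys_iff card_eq_0_iff)
qed

context group
begin

definition permanent_multiset :: "('a \<Rightarrow> 'a) \<Rightarrow> 'a multiset" where
  "permanent_multiset \<sigma> = image_mset (\<lambda>g. g \<otimes> inv (\<sigma> g)) (mset_set (carrier G))"

text \<open>
  Each permutation contributes one monomial with coefficient \<open>1\<close>, so distinct monomials correspond
  to the distinct multisets \<open>g \<otimes> inv (\<sigma> g)\<close>.
\<close>

lemma num_monomials_group_permanent:
  assumes fin: "finite (carrier G)"
  shows "num_monomials (group_permanent G) = card (permanent_multiset ` {\<sigma>. \<sigma> permutes carrier G})"
proof -
  have "(\<Sum>g\<in>carrier G. Poly_Mapping.single (g \<otimes> inv (\<sigma> g)) 1) = monomial_of (permanent_multiset \<sigma>)" for \<sigma>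
    by (simp add: monomial_of_def permanent_multiset_def image_mset.compositionality comp_def
          flip: sum_unfold_sum_mset)
  then have "group_permanent G =
    (\<Sum>\<sigma> | \<sigma> permutes carrier G. Poly_Mapping.single (monomial_of (permanent_multiset \<sigma>)) 1)"
    by (simp add: group_permanent_def permanent_def group_matrix_def mvar_def prod_single_1)
  then have "Poly_Mapping.keys (group_permanent G) =
      monomial_of ` permanent_multiset ` {\<sigma>. \<sigma> permutes carrier G}"
    using keys_sum_single_1[OF finite_permutations[OF fin], of "\<lambda>\<sigma>. monomial_of (permanent_multiset \<sigma>)"]
    by (simp add: image_image)
  then show ?thesis
    by (simp add: num_monomials_def card_image inj_on_subset[OF inj_monomial_of])
qed

end

lemma ex_image_mset_mset_set:
  assumes "finite I" "size X = card I"
  shows "\<exists>b. image_mset b (mset_set I) = X"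
  using assms
proof (induction I arbitrary: X rule: finite_induct)
  case (insert i I)
  then obtain x Y where X: "X = add_mset x Y" by (metis card_insert_disjoint size_eq_Suc_imp_eq_union)
  then obtain b where b: "image_mset b (mset_set I) = Y" using insert by force
  have "image_mset (b(i := x)) (mset_set I) = image_mset b (mset_set I)"
    using insert by (intro image_mset_cong) auto
  then have "image_mset (b(i := x)) (mset_set (insert i I)) = X"
    using X b insert by (simp del: image_mset_cong)
  then show ?case by blast
qed auto

context comm_group
begin

text \<open>
  The elements of \<open>permanent_multiset \<sigma>\<close> multiply to \<open>\<one>\<close> because \<open>g\<close> and \<open>\<sigma> g\<close> both run once
  through the group. Conversely, Hall's theorem yields enumerations \<open>a\<close> and \<open>c\<close> with
  \<open>c i = a i \<otimes> b i\<close>, and the permutation taking \<open>c i\<close> to \<open>a i\<close> produces the multiset of the \<open>b i\<close>.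
\<close>

lemma permanent_multisets_eq_product_one:
  assumes fin: "finite (carrier G)"
  shows "permanent_multiset ` {\<sigma>. \<sigma> permutes carrier G} =
    {image_mset b (mset_set (carrier G)) | b. b \<in> carrier G \<rightarrow> carrier G \<and> finprod G b (carrier G) = \<one>}"
    (is "?L = ?R")
proof
  show "?L \<subseteq> ?R"
  proof safe
    fix \<sigma> assume \<sigma>: "\<sigma> permutes carrier G"
    have \<sigma>G: "\<sigma> g \<in> carrier G" if "g \<in> carrier G" for g using \<sigma> that by (simp add: permutes_in_image)
    define b where "b g = g \<otimes> inv (\<sigma> g)" for g
    have bG: "b \<in> carrier G \<rightarrow> carrier G" using \<sigma>G by (auto simp: b_def)
    have "finprod G \<sigma> (carrier G) = finprod G (\<lambda>g. g) (carrier G)"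
      using finprod_reindex[of "\<lambda>g. g" \<sigma> "carrier G"] \<sigma> permutes_inj_on[OF \<sigma>]
      by (simp add: permutes_image)
    also have "finprod G (\<lambda>g. g) (carrier G) = finprod G (\<lambda>g. b g \<otimes> \<sigma> g) (carrier G)"
      using \<sigma>G by (intro finprod_cong) (auto simp: b_def m_assoc simp_implies_def)
    also have "\<dots> = finprod G b (carrier G) \<otimes> finprod G \<sigma> (carrier G)"
      using bG \<sigma>G by (intro finprod_multf) auto
    finally have "finprod G b (carrier G) = \<one>"
      using bG \<sigma>G by (metis Pi_I finprod_closed r_cancel_one')
    then show "\<exists>b. permanent_multiset \<sigma> = image_mset b (mset_set (carrier G)) \<and>
        b \<in> carrier G \<rightarrow> carrier G \<and> finprod G b (carrier G) = \<one>"
      using bG by (intro exI[of _ b]) (auto simp: permanent_multiset_def b_def[abs_def])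
  qed
next
  show "?R \<subseteq> ?L"
  proof safe
    fix b assume b: "b \<in> carrier G \<rightarrow> carrier G" "finprod G b (carrier G) = \<one>"
    obtain a where a: "bij_betw a (carrier G) (carrier G)"
      and c: "bij_betw (\<lambda>i. a i \<otimes> b i) (carrier G) (carrier G)"
      using hall_difference_theorem[OF fin _ fin b] by auto
    define c where "c i = a i \<otimes> b i" for i
    have c: "bij_betw c (carrier G) (carrier G)" using c by (simp add: c_def[abs_def])
    define \<sigma> where "\<sigma> g = (if g \<in> carrier G then a (inv_into (carrier G) c g) else g)" for g
    have \<sigma>c: "\<sigma> (c i) = a i" if "i \<in> carrier G" for i
      using that c by (auto simp: \<sigma>_def bij_betw_def)
    have "bij_betw \<sigma> (carrier G) (carrier G)"
      using bij_betw_trans[OF bij_betw_inv_into[OF c] a]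
      by (subst bij_betw_cong[of _ _ "a \<circ> inv_into (carrier G) c"]) (auto simp: \<sigma>_def)
    then have "\<sigma> permutes carrier G" by (rule bij_imp_permutes) (auto simp: \<sigma>_def)
    moreover have "permanent_multiset \<sigma> = image_mset b (mset_set (carrier G))"
    proof -
      have "permanent_multiset \<sigma> = image_mset (\<lambda>g. g \<otimes> inv (\<sigma> g)) (image_mset c (mset_set (carrier G)))"
        using c by (simp add: permanent_multiset_def bij_betw_def image_mset_mset_set)
      also have "\<dots> = image_mset b (mset_set (carrier G))"
        unfolding multiset.map_comp
      proof (intro image_mset_cong)
        fix i assume "i \<in># mset_set (carrier G)"
        then have i: "i \<in> carrier G" using fin by simp
        have "a i \<in> carrier G" "b i \<in> carrier G" using i a b by (auto simp: bij_betw_def)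
        then show "((\<lambda>g. g \<otimes> inv \<sigma> g) \<circ> c) i = b i"
          using \<sigma>c[OF i] by (simp add: c_def m_comm[of "a i"] m_assoc)
      qed
      finally show ?thesis .
    qed
    ultimately show "image_mset b (mset_set (carrier G)) \<in> permanent_multiset ` {\<sigma>. \<sigma> permutes carrier G}"
      by (metis (mono_tags, lifting) image_eqI mem_Collect_eq)
  qed
qed

definition character :: "('a \<Rightarrow> complex) \<Rightarrow> bool" where
  "character \<chi> \<longleftrightarrow> (\<forall>x\<in>carrier G. \<forall>y\<in>carrier G. \<chi> (x \<otimes> y) = \<chi> x * \<chi> y) \<and> \<chi> \<one> = 1"

lemma character_finprod:
  assumes "character \<chi>" "finite I" "b \<in> I \<rightarrow> carrier G"
  shows "\<chi> (finprod G b I) = (\<Prod>i\<in>I. \<chi> (b i))"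
  using assms(2,3)
proof (induction I rule: finite_induct)
  case (insert i I)
  have "b \<in> I \<rightarrow> carrier G" "b i \<in> carrier G" using insert.prems by auto
  then have "finprod G b (insert i I) = b i \<otimes> finprod G b I" "finprod G b I \<in> carrier G"
    using insert.hyps by (auto intro: finprod_insert)
  then show ?case
    using insert assms(1) \<open>b i \<in> carrier G\<close> \<open>b \<in> I \<rightarrow> carrier G\<close> by (simp add: character_def)
qed (use assms(1) in \<open>auto simp: character_def\<close>)

text \<open>
  Orthogonality detects the multisets with product \<open>\<one>\<close>. A character evaluated at the product of
  a multiset is a product over the multiset itself, so the sum over all multisets is a
  complete homogeneous symmetric polynomial in the values of the character.
\<close>

lemma card_permanent_multisets_by_characters:
  assumes fin: "finite (carrier G)"
    and char: "\<And>y. y \<in> K \<Longrightarrow> character (\<chi> y)"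
    and orth: "\<And>x. x \<in> carrier G \<Longrightarrow> (\<Sum>y\<in>K. \<chi> y x) = (if x = \<one> then of_nat (card (carrier G)) else 0)"
  shows "of_nat (card (carrier G) * card (permanent_multiset ` {\<sigma>. \<sigma> permutes carrier G})) =
    (\<Sum>y\<in>K. \<Sum>X\<in>multisets_of_size (carrier G) (card (carrier G)). \<Prod>g\<in>carrier G. \<chi> y g ^ count X g)"
proof -
  let ?M = "multisets_of_size (carrier G) (card (carrier G))"
  let ?R = "{image_mset b (mset_set (carrier G)) | b. b \<in> carrier G \<rightarrow> carrier G \<and> finprod G b (carrier G) = \<one>}"
  have RM: "?R \<subseteq> ?M" using fin by (auto simp: multisets_of_size_def)
  have prod_count: "(\<Prod>g\<in>carrier G. \<chi> y g ^ count (image_mset b (mset_set (carrier G))) g)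
      = \<chi> y (finprod G b (carrier G))" if "y \<in> K" "b \<in> carrier G \<rightarrow> carrier G" for y b
  proof -
    let ?X = "image_mset b (mset_set (carrier G))"
    have "(\<Prod>g\<in>carrier G. \<chi> y g ^ count ?X g) = (\<Prod>g\<in>set_mset ?X. \<chi> y g ^ count ?X g)"
    proof (intro prod.mono_neutral_right fin)
      show "set_mset ?X \<subseteq> carrier G" using that fin by auto
    qed (auto simp del: set_image_mset simp: not_in_iff)
    also have "\<dots> = (\<Prod>g\<in>#?X. \<chi> y g)" by (simp add: image_prod_mset_multiplicity)
    also have "\<dots> = (\<Prod>i\<in>carrier G. \<chi> y (b i))"
      by (simp add: prod_unfold_prod_mset image_mset.compositionality comp_def)
    finally show ?thesis using character_finprod[OF char fin] that by simp
  qed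
  have sum_eq: "(\<Sum>y\<in>K. \<Prod>g\<in>carrier G. \<chi> y g ^ count X g) = (if X \<in> ?R then of_nat (card (carrier G)) else 0)"
    if X: "X \<in> ?M" for X
  proof -
    obtain b where b: "image_mset b (mset_set (carrier G)) = X"
      using ex_image_mset_mset_set[OF fin, of X] X by (auto simp: multisets_of_size_def)
    have bG: "b \<in> carrier G \<rightarrow> carrier G" using X b fin by (auto simp: multisets_of_size_def)
    have *: "(\<Sum>y\<in>K. \<Prod>g\<in>carrier G. \<chi> y g ^ count X g) =
        (if finprod G b' (carrier G) = \<one> then of_nat (card (carrier G)) else 0)"
      if "b' \<in> carrier G \<rightarrow> carrier G" "X = image_mset b' (mset_set (carrier G))" for b'
      using that orth[of "finprod G b' (carrier G)"] prod_count[of _ b'] by simp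
    show ?thesis
    proof (cases "X \<in> ?R")
      case True
      then show ?thesis using * by auto
    next
      case False
      then have "finprod G b (carrier G) \<noteq> \<one>" using b bG by auto
      then show ?thesis using *[OF bG b[symmetric]] False by (simp only: if_False)
    qed
  qed
  have "(\<Sum>y\<in>K. \<Sum>X\<in>?M. \<Prod>g\<in>carrier G. \<chi> y g ^ count X g) =
      (\<Sum>X\<in>?M. if X \<in> ?R then of_nat (card (carrier G)) else 0)"
    by (subst sum.swap) (intro sum.cong refl sum_eq)
  also have "\<dots> = of_nat (card (?M \<inter> ?R) * card (carrier G))"
    using fin by (subst sum.If_cases) (auto simp: finite_multisets_of_size)
  also have "?M \<inter> ?R = ?R" using RM by blast
  finally show ?thesis
    unfolding permanent_multisets_eq_product_one[OF fin] by (simp add: mult.commute)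
qed

end

section \<open>Roots of unity and the geometric series\<close>

definition unity_root :: "nat \<Rightarrow> int \<Rightarrow> complex" where
  "unity_root q a = cis (2 * pi * of_int a / of_nat q)"

lemma unity_root_add: "unity_root q (a + b) = unity_root q a * unity_root q b"
  by (simp add: unity_root_def cis_mult add_divide_distrib distrib_left)

lemma unity_root_0 [simp]: "unity_root q 0 = 1"
  by (simp add: unity_root_def)

lemma unity_root_power: "unity_root q a ^ m = unity_root q (int m * a)"
  by (simp add: unity_root_def DeMoivre mult_ac)

lemma unity_root_eq_1_iff:
  assumes "q > 0"
  shows "unity_root q a = 1 \<longleftrightarrow> int q dvd a"
proof
  assume "unity_root q a = 1"
  then have "cos (2 * pi * of_int a / of_nat q) = 1"
    by (simp add: unity_root_def complex_eq_iff)
  then obtain m :: int where "2 * pi * of_int a / of_nat q = of_int m * 2 * pi"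
    by (subst (asm) cos_one_2pi_int) blast
  then have "real_of_int a = of_int (m * int q)"
    using assms by (simp add: field_simps)
  then show "int q dvd a" by (simp only: of_int_eq_iff dvd_triv_right)
next
  assume "int q dvd a"
  then obtain m where m: "a = int q * m" by blast
  have "unity_root q a = cis (2 * pi * of_int m)"
    using assms unfolding unity_root_def m by (intro arg_cong[of _ _ cis]) simp
  also have "\<dots> = 1" by (rule cis_multiple_2pi) simp
  finally show "unity_root q a = 1" .
qed

lemma unity_root_mod:
  assumes "q > 0"
  shows "unity_root q (a mod int q) = unity_root q a"
proof -
  have "unity_root q a = unity_root q (a div int q * int q) * unity_root q (a mod int q)"
    by (simp flip: unity_root_add)
  moreover have "unity_root q (a div int q * int q) = 1"
    using unity_root_eq_1_iff[OF assms] by simp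
  ultimately show ?thesis by simp
qed

lemma sum_unity_root:
  assumes "q > 0"
  shows "(\<Sum>y\<in>{0..<int q}. unity_root q (x * y)) = (if int q dvd x then of_nat q else 0)"
proof -
  have "(\<Sum>y\<in>{0..<int q}. unity_root q (x * y)) = (\<Sum>k<q. unity_root q (x * int k))"
    using sum.reindex[of int "{..<q}" "\<lambda>y. unity_root q (x * y)"]
    by (simp add: image_int_atLeastLessThan flip: atLeast0LessThan)
  also have "\<dots> = (\<Sum>k<q. unity_root q x ^ k)"
    by (simp add: unity_root_power mult.commute)
  also have "\<dots> = (if int q dvd x then of_nat q else 0)"
  proof (cases "int q dvd x")
    case True
    then have "unity_root q x = 1" using unity_root_eq_1_iff[OF assms] by blast
    then show ?thesis using True by simp
  next
    case False
    have "unity_root q x ^ q = 1"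
      using unity_root_eq_1_iff[OF assms] by (simp add: unity_root_power)
    then show ?thesis
      using False unity_root_eq_1_iff[OF assms] by (simp add: geometric_sum)
  qed
  finally show ?thesis .
qed

text \<open>
  The two sides have degree at most \<open>d\<close> and agree at \<open>d + 1\<close> points: at the \<open>d\<close> roots of unity, where
  both vanish, and at \<open>0\<close>, where both are \<open>1\<close>.
\<close>

lemma prod_one_minus_roots_of_unity:
  assumes "d > 0"
  shows "(\<Prod>z | z ^ d = (1::complex). [:1, - z:]) = 1 - Polynomial.monom 1 d"
proof (rule ccontr)
  let ?R = "{z::complex. z ^ d = 1}"
  let ?P = "\<Prod>z\<in>?R. [:1, - z:]"
  let ?D = "?P - (1 - Polynomial.monom 1 d)"
  assume "\<not> ?thesis"
  then have D: "?D \<noteq> 0" by simp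
  have fin: "finite ?R" and card: "card ?R = d"
    using assms card_roots_unity_eq[OF assms] by (auto intro: finite_roots_unity)
  have "degree ?P \<le> (\<Sum>z\<in>?R. degree [:1, - z:])"
    using degree_prod_sum_le[OF fin, of "\<lambda>z. [:1, - z:]"] by (simp only: comp_def)
  also have "\<dots> \<le> (\<Sum>z\<in>?R. 1)" by (intro sum_mono) (simp add: degree_pCons_eq_if)
  finally have "degree ?P \<le> d" by (simp add: card)
  moreover have "degree (1 - Polynomial.monom (1::complex) d) \<le> d"
    by (intro degree_diff_le degree_monom_le) auto
  ultimately have deg: "degree ?D \<le> d" by (rule degree_diff_le)
  have "insert 0 ?R \<subseteq> {x. poly ?D x = 0}"
  proof
    fix x assume "x \<in> insert 0 ?R"
    then consider "x = 0" | "x \<in> ?R" by auto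
    then show "x \<in> {x. poly ?D x = 0}"
    proof cases
      case 1
      then show ?thesis using assms by (simp add: poly_prod poly_monom)
    next
      case 2
      then have x0: "x \<noteq> 0" using assms by (auto simp: power_0_left)
      have "inverse x \<in> ?R" using 2 by (simp add: power_inverse)
      then have "poly ?P x = 0"
        unfolding poly_prod using fin x0 by (intro prod_zero bexI[of _ "inverse x"]) auto
      then show ?thesis using 2 by (simp add: poly_monom)
    qed
  qed
  then have "card (insert 0 ?R) \<le> card {x. poly ?D x = 0}"
    using D by (intro card_mono poly_roots_finite)
  also have "\<dots> \<le> d" using card_poly_roots_bound[OF D] deg by linarith
  finally show False using fin card assms by (simp add: power_0_left)
qed

lemma geometric_fps_inverse:
  "(1 - fps_const c * fps_X) * Abs_fps (\<lambda>k. c ^ k) = (1 :: 'a::comm_ring_1 fps)"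
proof (rule fps_ext)
  fix k
  show "((1 - fps_const c * fps_X) * Abs_fps (\<lambda>k. c ^ k)) $ k = (1 :: 'a fps) $ k"
    by (cases k) (simp_all add: left_diff_distrib mult.assoc)
qed

text \<open>
  Expanding the power of the geometric series as a product over \<open>m\<close> factors counts the multisets
  of size \<open>k\<close> on \<open>m\<close> elements.
\<close>

lemma fps_nth_geometric_power:
  "(Abs_fps (\<lambda>_. 1) ^ m :: 'a::comm_ring_1 fps) $ k = of_nat ((m + k - 1) choose k)"
proof -
  have "(Abs_fps (\<lambda>_. 1) ^ m :: 'a fps) = (\<Prod>i<m. Abs_fps (\<lambda>_. 1))" by simp
  also have "\<dots> $ k = of_nat ((m + k - 1) choose k)"
    by (subst fps_prod_nth') (simp_all add: card_multisets_of_size)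
  finally show ?thesis .
qed

section \<open>Complete homogeneous sums over the values of a character\<close>

context comm_group
begin

text \<open>
  Multiplication by \<open>\<chi> x\<close> permutes the image of \<open>\<chi>\<close>, so comparing the products of all elements of
  the image before and after shows that \<open>\<chi> x\<close> is a \<open>d\<close>-th root of unity, where \<open>d\<close> is the size of
  the image; by cardinality the image contains them all. Any two fibres are translates of each
  other.
\<close>

lemma
  assumes fin: "finite (carrier G)" and char: "character \<chi>"
  shows character_image_eq_roots_of_unity:
      "\<chi> ` carrier G = {z. z ^ card (\<chi> ` carrier G) = 1}"
    and card_character_fiber:
      "\<And>z. z \<in> \<chi> ` carrier G \<Longrightarrow>
        card {g \<in> carrier G. \<chi> g = z} * card (\<chi> ` carrier G) = card (carrier G)"
proof -
  let ?I = "\<chi> ` carrier G"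
  let ?d = "card ?I"
  have mult: "\<chi> (x \<otimes> y) = \<chi> x * \<chi> y" if "x \<in> carrier G" "y \<in> carrier G" for x y
    using char that by (simp add: character_def)
  have one: "\<chi> \<one> = 1" using char by (simp add: character_def)
  have nz: "\<chi> x \<noteq> 0" if "x \<in> carrier G" for x
    using mult[OF that inv_closed[OF that]] that one by auto
  have finI: "finite ?I" using fin by simp
  have d: "?d > 0" using fin by (auto simp: card_gt_0_iff)
  have "?I \<subseteq> {z. z ^ ?d = 1}"
  proof safe
    fix x assume x: "x \<in> carrier G"
    have "(*) (\<chi> x) ` ?I \<subseteq> ?I" using x by (auto simp flip: mult)
    then have im: "(*) (\<chi> x) ` ?I = ?I"
      using nz[OF x] finI by (intro endo_inj_surj) (auto simp: inj_on_def)
    have "(\<Prod>w\<in>?I. w) = (\<Prod>w\<in>(*) (\<chi> x) ` ?I. w)" by (simp only: im)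
    also have "\<dots> = (\<Prod>w\<in>?I. \<chi> x * w)"
      using nz[OF x] by (subst prod.reindex) (auto simp: inj_on_def)
    also have "\<dots> = \<chi> x ^ ?d * (\<Prod>w\<in>?I. w)" by (simp add: prod.distrib)
    finally show "\<chi> x ^ ?d = 1" using nz finI by auto
  qed
  then show im: "?I = {z. z ^ ?d = 1}"
    using d by (intro card_subset_eq finite_roots_unity) (auto simp: card_roots_unity_eq)
  have fiber: "card {g \<in> carrier G. \<chi> g = \<chi> x} = card {g \<in> carrier G. \<chi> g = 1}" if x: "x \<in> carrier G" for x
  proof -
    have "bij_betw (\<lambda>g. x \<otimes> g) {g \<in> carrier G. \<chi> g = 1} {g \<in> carrier G. \<chi> g = \<chi> x}"
    proof (rule bij_betw_imageI)
      show "inj_on (\<lambda>g. x \<otimes> g) {g \<in> carrier G. \<chi> g = 1}" using x by (auto simp: inj_on_def)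
      show "(\<lambda>g. x \<otimes> g) ` {g \<in> carrier G. \<chi> g = 1} = {g \<in> carrier G. \<chi> g = \<chi> x}" (is "?A = ?B")
      proof
        show "?A \<subseteq> ?B" using x mult by auto
        show "?B \<subseteq> ?A"
        proof
          fix h assume h: "h \<in> ?B"
          then have "\<chi> x * \<chi> (inv x \<otimes> h) = \<chi> x"
            using x by (simp flip: mult add: m_assoc[symmetric])
          then have "\<chi> (inv x \<otimes> h) = 1" using nz[OF x] by simp
          moreover have "h = x \<otimes> (inv x \<otimes> h)" using h x by (simp flip: m_assoc)
          ultimately show "h \<in> ?A" using h x by blast
        qed
      qed
    qed
    then show ?thesis by (simp add: bij_betw_same_card)
  qed
  have "card (carrier G) = (\<Sum>z\<in>?I. card {g \<in> carrier G. \<chi> g = z})"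
    using sum.image_gen[OF fin, of "\<lambda>_. 1::nat" \<chi>] by simp
  also have "\<dots> = (\<Sum>z\<in>?I. card {g \<in> carrier G. \<chi> g = 1})"
    using fiber by (intro sum.cong) auto
  finally have "card (carrier G) = ?d * card {g \<in> carrier G. \<chi> g = 1}" by simp
  then show "card {g \<in> carrier G. \<chi> g = z} * ?d = card (carrier G)" if "z \<in> ?I" for z
    using that fiber by auto
qed

text \<open>
  The image is the group of \<open>d\<close>-th roots of unity, which contains a primitive one.
\<close>

lemma card_character_image_dvd_iff:
  assumes fin: "finite (carrier G)" and char: "character \<chi>"
  shows "card (\<chi> ` carrier G) dvd k \<longleftrightarrow> (\<forall>g\<in>carrier G. \<chi> g ^ k = 1)"
proof -
  let ?d = "card (\<chi> ` carrier G)"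
  have d: "?d > 0" using fin by (auto simp: card_gt_0_iff)
  have im: "\<chi> ` carrier G = {z. z ^ ?d = 1}" by (rule character_image_eq_roots_of_unity[OF fin char])
  show ?thesis
  proof
    assume "?d dvd k"
    then obtain l where l: "k = ?d * l" by blast
    have "\<chi> g ^ ?d = 1" if "g \<in> carrier G" for g using im that by blast
    then show "\<forall>g\<in>carrier G. \<chi> g ^ k = 1" unfolding l power_mult by simp
  next
    assume *: "\<forall>g\<in>carrier G. \<chi> g ^ k = 1"
    have "unity_root ?d 1 ^ ?d = 1"
      using unity_root_eq_1_iff[OF d] by (simp add: unity_root_power)
    then have "unity_root ?d 1 \<in> \<chi> ` carrier G" using im by blast
    then have "unity_root ?d 1 ^ k = 1" using * by auto
    then show "?d dvd k"
      using unity_root_eq_1_iff[OF d] by (simp add: unity_root_power)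
  qed
qed

text \<open>
  The sum is the coefficient at \<open>X ^ n\<close>, with \<open>n\<close> the order of the group, of the product of the series
  \<open>1 / (1 - \<chi> g * X)\<close> over all \<open>g\<close>. Every \<open>d\<close>-th root of unity is the value of \<open>\<chi>\<close> at exactly
  \<open>m\<close> elements, so this product is \<open>1 / (1 - X ^ d) ^ m\<close>, whose coefficient at \<open>X ^ (d * m)\<close> is
  that of \<open>1 / (1 - X) ^ m\<close> at \<open>X ^ m\<close>.
\<close>

lemma sum_multisets_character:
  assumes fin: "finite (carrier G)" and char: "character \<chi>"
    and m: "card (carrier G) = card (\<chi> ` carrier G) * m"
  shows "(\<Sum>X\<in>multisets_of_size (carrier G) (card (carrier G)). \<Prod>g\<in>carrier G. \<chi> g ^ count X g)
    = of_nat ((2 * m - 1) choose m)"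
proof -
  let ?d = "card (\<chi> ` carrier G)"
  let ?A = "Abs_fps (\<lambda>_. 1) :: complex fps"
  define Q where "Q = (\<Prod>g\<in>carrier G. Abs_fps (\<lambda>k. \<chi> g ^ k))"
  define P where "P = (\<Prod>g\<in>carrier G. 1 - fps_const (\<chi> g) * fps_X)"
  have d: "?d > 0" using fin by (auto simp: card_gt_0_iff)
  have PQ: "P * Q = 1"
    unfolding P_def Q_def by (simp add: geometric_fps_inverse flip: prod.distrib)
  have "P = (\<Prod>z\<in>\<chi> ` carrier G. \<Prod>g\<in>{g\<in>carrier G. \<chi> g = z}. 1 - fps_const (\<chi> g) * fps_X)"
    unfolding P_def using fin by (intro prod.group[symmetric]) auto
  also have "\<dots> = (\<Prod>z\<in>\<chi> ` carrier G. (1 - fps_const z * fps_X) ^ m)"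
  proof (intro prod.cong refl)
    fix z assume "z \<in> \<chi> ` carrier G"
    then have "card {g \<in> carrier G. \<chi> g = z} * ?d = card (carrier G)"
      by (rule card_character_fiber[OF fin char])
    then have "card {g \<in> carrier G. \<chi> g = z} = m" using m d by simp
    then show "(\<Prod>g\<in>{g\<in>carrier G. \<chi> g = z}. 1 - fps_const (\<chi> g) * fps_X) = (1 - fps_const z * fps_X) ^ m"
      by simp
  qed
  also have "\<dots> = (\<Prod>z\<in>\<chi> ` carrier G. 1 - fps_const z * fps_X) ^ m"
    by (simp add: prod_power_distrib)
  also have "(\<Prod>z\<in>\<chi> ` carrier G. 1 - fps_const z * fps_X)
      = fps_of_poly (\<Prod>z\<in>\<chi> ` carrier G. [:1, - z:])"
    by (simp add: fps_of_poly_prod fps_of_poly_pCons mult.commute flip: fps_const_neg)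
  also have "(\<Prod>z\<in>\<chi> ` carrier G. [:1, - z:]) = 1 - Polynomial.monom 1 ?d"
    using prod_one_minus_roots_of_unity[OF d] character_image_eq_roots_of_unity[OF fin char] by simp
  also have "fps_of_poly \<dots> = 1 - fps_X ^ ?d"
    by (simp add: fps_of_poly_diff fps_of_poly_monom')
  finally have P: "P = (1 - fps_X ^ ?d) ^ m" .
  have "(1 - fps_X ^ ?d) * (?A oo fps_X ^ ?d) = ((1 - fps_X) * ?A) oo fps_X ^ ?d"
    using d by (simp add: fps_compose_mult_distrib fps_compose_sub_distrib)
  also have "(1 - fps_X) * ?A = 1" using geometric_fps_inverse[of "1::complex"] by simp
  finally have inv: "(1 - fps_X ^ ?d) * (?A oo fps_X ^ ?d) = 1" by simp
  have "Q = Q * ((1 - fps_X ^ ?d) * (?A oo fps_X ^ ?d)) ^ m" unfolding inv by simp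
  also have "\<dots> = P * Q * (?A oo fps_X ^ ?d) ^ m" by (simp add: P power_mult_distrib mult_ac)
  also have "\<dots> = ?A ^ m oo fps_X ^ ?d" using PQ d by (simp add: fps_compose_power)
  finally have Q: "Q = ?A ^ m oo fps_X ^ ?d" .
  have "(\<Sum>X\<in>multisets_of_size (carrier G) (card (carrier G)). \<Prod>g\<in>carrier G. \<chi> g ^ count X g) = Q $ card (carrier G)"
    unfolding Q_def using fin by (simp add: fps_prod_nth')
  also have "\<dots> = (?A ^ m) $ m" unfolding Q using d m by (simp add: fps_nth_compose_X_power)
  also have "\<dots> = of_nat ((2 * m - 1) choose m)" by (simp add: fps_nth_geometric_power mult_2)
  finally show ?thesis .
qed

end

section \<open>Characters of an abelian p-group\<close>

text \<open>
  With \<open>l = min k t\<close>, the condition says that \<open>y\<close> is a multiple of \<open>u = p ^ (k - l)\<close>, and there are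
  \<open>v = p ^ l\<close> such multiples below \<open>p ^ k = v * u\<close>.
\<close>

lemma card_power_dvd_mult:
  assumes "p > 0"
  shows "card {y \<in> {0..<int (p ^ k)}. int (p ^ k) dvd int (p ^ t) * y} = p ^ min k t"
proof -
  define l where "l = min k t"
  define u where "u = int (p ^ (k - l))"
  define v where "v = int (p ^ l)"
  have uv: "u > 0" "v > 0" using assms by (simp_all add: u_def v_def)
  have pk: "int (p ^ k) = v * u"
    by (simp add: l_def u_def v_def flip: power_add)
  have pt: "int (p ^ t) = v * int (p ^ (t - l))"
    by (simp add: l_def v_def flip: power_add)
  have "k - l = 0 \<or> t - l = 0" by (auto simp: l_def)
  then have "u = 1 \<or> int (p ^ (t - l)) = 1" by (auto simp: u_def)
  then have dvd: "int (p ^ k) dvd int (p ^ t) * y \<longleftrightarrow> u dvd y" for y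
    using uv unfolding pk pt mult.assoc by auto
  have "{y \<in> {0..<int (p ^ k)}. int (p ^ k) dvd int (p ^ t) * y} = (*) u ` {0..<v}"
  proof (intro equalityI subsetI)
    fix y assume "y \<in> {y \<in> {0..<int (p ^ k)}. int (p ^ k) dvd int (p ^ t) * y}"
    then have "u dvd y" and y: "0 \<le> y" "y < u * v" unfolding dvd unfolding pk by (auto simp: mult.commute)
    then obtain z where z: "y = u * z" by blast
    then have "0 \<le> z" "z < v" using y uv by (auto simp: zero_le_mult_iff)
    then show "y \<in> (*) u ` {0..<v}" using z by auto
  next
    fix y assume "y \<in> (*) u ` {0..<v}"
    then show "y \<in> {y \<in> {0..<int (p ^ k)}. int (p ^ k) dvd int (p ^ t) * y}"
      unfolding dvd unfolding pk using uv by (auto simp: mult.commute)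
  qed
  moreover have "inj_on ((*) u) {0..<v}" using uv by (auto simp: inj_on_def)
  ultimately show ?thesis by (simp add: card_image l_def v_def nat_power_eq)
qed

context
  fixes p :: nat and ks :: "nat list"
  assumes p: "p > 1" and pos: "\<And>k. k \<in> set ks \<Longrightarrow> k \<ge> 1"
begin

lemma carrier_abelian_p_group: "carrier (abelian_p_group p ks) = (\<Pi>\<^sub>E i\<in>{..<length ks}. {0..<int (p ^ (ks ! i))})"
  using p by (simp add: abelian_p_group_def carrier_integer_mod_group)

lemma finite_abelian_p_group: "finite (carrier (abelian_p_group p ks))"
  unfolding carrier_abelian_p_group by (intro finite_PiE) auto

lemma comm_group_abelian_p_group: "comm_group (abelian_p_group p ks)"
proof -
  interpret group "abelian_p_group p ks" by (rule group_abelian_p_group)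
  show ?thesis
    by (rule group_comm_groupI) (simp add: abelian_p_group_def add.commute)
qed

text \<open>
  All characters of the group, parametrised by the elements \<open>y\<close> of the group itself: the pairing
  of \<open>x\<close> and \<open>y\<close> is symmetric.
\<close>

definition pairing_character :: "(nat \<Rightarrow> int) \<Rightarrow> (nat \<Rightarrow> int) \<Rightarrow> complex" where
  "pairing_character y x = (\<Prod>i<length ks. unity_root (p ^ (ks ! i)) (x i * y i))"

lemma character_pairing: "comm_group.character (abelian_p_group p ks) (pairing_character y)"
proof -
  interpret comm_group "abelian_p_group p ks" by (rule comm_group_abelian_p_group)
  have q: "p ^ (ks ! i) > 0" for i using p by simp
  show ?thesis
    unfolding character_def
  proof (intro conjI ballI)
    fix x x' assume "x \<in> carrier (abelian_p_group p ks)" "x' \<in> carrier (abelian_p_group p ks)"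
    have "unity_root (p ^ (ks ! i)) (((x i + x' i) mod int (p ^ (ks ! i))) * y i) =
        unity_root (p ^ (ks ! i)) (x i * y i) * unity_root (p ^ (ks ! i)) (x' i * y i)" for i
      using unity_root_mod[OF q, of i "((x i + x' i) mod int (p ^ (ks ! i))) * y i"]
        unity_root_mod[OF q, of i "(x i + x' i) * y i"]
      by (simp add: mod_mult_left_eq distrib_right unity_root_add del: of_nat_power)
    then show "pairing_character y (x \<otimes>\<^bsub>abelian_p_group p ks\<^esub> x') = pairing_character y x * pairing_character y x'"
      by (simp add: pairing_character_def abelian_p_group_def flip: prod.distrib)
  qed (simp add: pairing_character_def abelian_p_group_def)
qed

lemma sum_pairing_character:
  assumes x: "x \<in> carrier (abelian_p_group p ks)"
  shows "(\<Sum>y\<in>carrier (abelian_p_group p ks). pairing_character y x) = (if x = \<one>\<^bsub>abelian_p_group p ks\<^esub> then of_nat (card (carrier (abelian_p_group p ks))) else 0)"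
proof -
  have q: "p ^ (ks ! i) > 0" for i using p by simp
  have "(\<Sum>y\<in>carrier (abelian_p_group p ks). pairing_character y x) =
      (\<Prod>i<length ks. \<Sum>y\<in>{0..<int (p ^ (ks ! i))}. unity_root (p ^ (ks ! i)) (x i * y))"
    unfolding carrier_abelian_p_group pairing_character_def
    by (subst prod_sum_PiE) auto
  also have "\<dots> = (\<Prod>i<length ks. if int (p ^ (ks ! i)) dvd x i then of_nat (p ^ (ks ! i)) else 0)"
    by (simp only: sum_unity_root[OF q])
  also have "\<dots> = (\<Prod>i<length ks. if x i = 0 then of_nat (p ^ (ks ! i)) else 0)"
  proof (intro prod.cong refl)
    fix i assume "i \<in> {..<length ks}"
    then have "0 \<le> x i" "x i < int (p ^ (ks ! i))" using x unfolding carrier_abelian_p_group by (auto dest!: PiE_mem)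
    then have "int (p ^ (ks ! i)) dvd x i \<longleftrightarrow> x i = 0" by (auto dest: zdvd_imp_le)
    then show "(if int (p ^ (ks ! i)) dvd x i then of_nat (p ^ (ks ! i)) else 0) = (if x i = 0 then of_nat (p ^ (ks ! i)) else (0 :: complex))"
      by simp
  qed
  also have "\<dots> = (if \<forall>i<length ks. x i = 0 then of_nat (\<Prod>i<length ks. p ^ (ks ! i)) else 0)"
    by (auto intro!: prod_zero)
  also have "(\<forall>i<length ks. x i = 0) \<longleftrightarrow> x = \<one>\<^bsub>abelian_p_group p ks\<^esub>"
    using x by (auto simp: abelian_p_group_def fun_eq_iff restrict_def PiE_iff extensional_def)
  also have "(\<Prod>i<length ks. p ^ (ks ! i)) = card (carrier (abelian_p_group p ks))"
    unfolding carrier_abelian_p_group by (simp add: card_PiE flip: of_nat_power)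
  finally show ?thesis .
qed

text \<open>
  Testing on the generator of each cyclic factor shows that the \<open>p ^ t\<close>-th power of the character
  of \<open>y\<close> is trivial iff \<open>p ^ t * y i\<close> vanishes modulo \<open>p ^ (ks ! i)\<close> for every \<open>i\<close>. Each coordinate
  leaves \<open>p ^ min (ks ! i) t\<close> choices, and the exponents add up to the boxes in the first \<open>t\<close>
  columns.
\<close>

lemma card_pairing_characters_torsion:
  "card {y \<in> carrier (abelian_p_group p ks). \<forall>x\<in>carrier (abelian_p_group p ks). pairing_character y x ^ (p ^ t) = 1} = p ^ column_boxes ks t"
proof -
  have q: "p ^ (ks ! i) > 0" for i using p by simp
  have q1: "p ^ (ks ! i) > 1" if "i < length ks" for i
    using p pos[of "ks ! i"] that by (intro one_less_power) auto
  have pow: "pairing_character y x ^ (p ^ t) = (\<Prod>i<length ks. unity_root (p ^ (ks ! i)) (int (p ^ t) * y i * x i))" for x y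
    by (simp add: pairing_character_def unity_root_power mult_ac prod_power_distrib del: of_nat_power)
  have "(\<forall>x\<in>carrier (abelian_p_group p ks). pairing_character y x ^ (p ^ t) = 1) \<longleftrightarrow>
      (\<forall>i<length ks. int (p ^ (ks ! i)) dvd int (p ^ t) * y i)" for y
  proof (intro iffI allI impI ballI)
    fix x i assume *: "\<forall>x\<in>carrier (abelian_p_group p ks). pairing_character y x ^ (p ^ t) = 1" and i: "i < length ks"
    define x where "x = (\<lambda>j\<in>{..<length ks}. if j = i then 1 else 0 :: int)"
    have "x \<in> carrier (abelian_p_group p ks)"
      unfolding carrier_abelian_p_group x_def using q q1 i by (auto simp del: of_nat_power)
    with * have "(\<Prod>j<length ks. unity_root (p ^ (ks ! j)) (int (p ^ t) * y j * x j)) = 1"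
      using pow by metis
    moreover have "(\<Prod>j<length ks. unity_root (p ^ (ks ! j)) (int (p ^ t) * y j * x j)) =
        (\<Prod>j<length ks. if j = i then unity_root (p ^ (ks ! i)) (int (p ^ t) * y i) else 1)"
      by (intro prod.cong) (auto simp: x_def)
    ultimately have "unity_root (p ^ (ks ! i)) (int (p ^ t) * y i) = 1" using i by simp
    then show "int (p ^ (ks ! i)) dvd int (p ^ t) * y i" using unity_root_eq_1_iff[OF q] by blast
  next
    fix x assume "\<forall>i<length ks. int (p ^ (ks ! i)) dvd int (p ^ t) * y i"
    then have "unity_root (p ^ (ks ! i)) (int (p ^ t) * y i * x i) = 1" if "i < length ks" for i
      using unity_root_eq_1_iff[OF q] that by (blast intro: dvd_mult2)
    then show "pairing_character y x ^ (p ^ t) = 1" unfolding pow by (intro prod.neutral) auto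
  qed
  then have "{y \<in> carrier (abelian_p_group p ks). \<forall>x\<in>carrier (abelian_p_group p ks). pairing_character y x ^ (p ^ t) = 1} =
      (\<Pi>\<^sub>E i\<in>{..<length ks}. {y \<in> {0..<int (p ^ (ks ! i))}. int (p ^ (ks ! i)) dvd int (p ^ t) * y})"
    unfolding carrier_abelian_p_group by (auto simp: PiE_iff extensional_def simp del: of_nat_power)
  then have "card {y \<in> carrier (abelian_p_group p ks). \<forall>x\<in>carrier (abelian_p_group p ks). pairing_character y x ^ (p ^ t) = 1} =
      (\<Prod>i<length ks. p ^ min (ks ! i) t)"
    using card_power_dvd_mult[of p] p by (simp add: card_PiE del: of_nat_power)
  also have "\<dots> = p ^ column_boxes ks t"
    by (simp add: column_boxes_def power_sum)
  finally show ?thesis .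
qed

end

section \<open>Counting the monomials\<close>

lemma two_mult_choose_pred:
  assumes "m > 0"
  shows "2 * ((2 * m - 1) choose m) = (2 * m) choose m"
proof -
  obtain k where k: "m = Suc k" using assms gr0_implies_Suc by blast
  have "(2 * m) choose m = ((2 * k + 1) choose k) + ((2 * k + 1) choose (Suc k))"
    by (simp add: k)
  also have "(2 * k + 1) choose k = (2 * k + 1) choose (Suc k)"
    by (subst binomial_symmetric) auto
  finally show ?thesis by (simp add: k)
qed

theorem theorem1p1:
  fixes p N :: nat and ks :: "nat list"
  assumes "prime p" and "N \<ge> 1" and "is_partition N ks"
  shows "real (num_monomials (group_permanent (abelian_p_group p ks))) =
    1 + 1 / (2 * real p ^ N) *
      (\<Sum>t = 0..N - 1. real p ^ column_boxes ks t * (real (\<beta> p N t) - real (\<beta> p N (t + 1))))"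
proof -
  let ?G = "abelian_p_group p ks"
  let ?\<chi> = "pairing_character p ks"
  let ?W = "num_monomials (group_permanent ?G)"
  let ?S = "\<Sum>t<N. real p ^ column_boxes ks t * (real (\<beta> p N t) - real (\<beta> p N (t + 1)))"
  have p: "p > 1" using assms(1) by (rule prime_gt_1_nat)
  have pos: "k \<ge> 1" if "k \<in> set ks" for k using assms(3) that by (simp add: is_partition_def)
  interpret comm_group ?G using p pos by (rule comm_group_abelian_p_group)
  have fin: "finite (carrier ?G)" using p pos by (rule finite_abelian_p_group)
  have card: "card (carrier ?G) = p ^ N"
    using order_abelian_p_group[OF _ assms(3), of p] p by (simp add: Coset.order_def)
  have char: "character (?\<chi> y)" for y using p pos by (rule character_pairing)
  have "\<exists>s\<le>N. card (?\<chi> y ` carrier ?G) = p ^ s" for y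
  proof -
    obtain x where "x \<in> ?\<chi> y ` carrier ?G" using one_closed by blast
    then have "card (?\<chi> y ` carrier ?G) dvd p ^ N"
      using card_character_fiber[OF fin char, of x y] card by (metis dvd_triv_right)
    then show ?thesis using divides_primepow_nat[OF assms(1)] by blast
  qed
  \<comment> \<open>\<open>p ^ s y\<close> is the order of the character of \<open>y\<close>.\<close>
  then obtain s where s: "\<And>y. s y \<le> N" "\<And>y. card (?\<chi> y ` carrier ?G) = p ^ s y" by metis
  have s_le_iff: "s y \<le> t \<longleftrightarrow> (\<forall>x\<in>carrier ?G. ?\<chi> y x ^ (p ^ t) = 1)" for y t
    using card_character_image_dvd_iff[OF fin char, of y "p ^ t"] p unfolding s(2)
    by (simp add: dvd_power_iff_le)
  have inner: "2 * (\<Sum>X\<in>multisets_of_size (carrier ?G) (card (carrier ?G)). \<Prod>g\<in>carrier ?G. ?\<chi> y g ^ count X g)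
      = of_nat (\<beta> p N (s y))" for y
  proof -
    have "card (carrier ?G) = card (?\<chi> y ` carrier ?G) * p ^ (N - s y)"
      unfolding card s(2) using s(1)[of y] by (simp flip: power_add)
    note sum = sum_multisets_character[OF fin char this]
    have "\<beta> p N (s y) = 2 * ((2 * p ^ (N - s y) - 1) choose (p ^ (N - s y)))"
      unfolding \<beta>_def using p by (intro two_mult_choose_pred[symmetric]) simp
    then show ?thesis unfolding sum by simp
  qed
  have "of_nat (2 * (p ^ N * ?W)) = (\<Sum>y\<in>carrier ?G. of_nat (\<beta> p N (s y)) :: complex)"
    unfolding inner[symmetric] sum_distrib_left[symmetric] num_monomials_group_permanent[OF fin]
    using card_permanent_multisets_by_characters[OF fin char sum_pairing_character[OF p pos]]
    by (simp add: card)
  then have "2 * (p ^ N * ?W) = (\<Sum>y\<in>carrier ?G. \<beta> p N (s y))"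
    by (simp only: of_nat_sum[symmetric] of_nat_eq_iff)
  then have "real (2 * (p ^ N * ?W)) = real (\<Sum>y\<in>carrier ?G. \<beta> p N (s y))"
    by (rule arg_cong)
  then have "2 * real p ^ N * real ?W = (\<Sum>y\<in>carrier ?G. real (\<beta> p N (s y)))"
    by (simp add: mult.assoc)
  \<comment> \<open>Telescoping from \<open>s y\<close> up to \<open>N\<close>, where \<open>\<beta> p N N = 2\<close>, turns the number of characters of
    order exactly \<open>p ^ t\<close> into the number of those of order dividing \<open>p ^ t\<close>.\<close>
  also have "\<dots> = (\<Sum>y\<in>carrier ?G. 2 + (\<Sum>t<N. if s y \<le> t then real (\<beta> p N t) - real (\<beta> p N (t + 1)) else 0))"
  proof (intro sum.cong refl)
    fix y
    have "(\<Sum>t<N. if s y \<le> t then real (\<beta> p N t) - real (\<beta> p N (t + 1)) else 0) =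
        (\<Sum>t\<in>{s y..<N}. real (\<beta> p N t) - real (\<beta> p N (Suc t)))"
      by (intro sum.mono_neutral_cong_right) auto
    also have "\<dots> = real (\<beta> p N (s y)) - real (\<beta> p N N)"
      using s(1)[of y] by (rule sum_Suc_diff'[of _ _ "\<lambda>t. - real (\<beta> p N t)", simplified])
    also have "real (\<beta> p N N) = 2" by (simp add: \<beta>_def)
    finally show "real (\<beta> p N (s y)) =
      2 + (\<Sum>t<N. if s y \<le> t then real (\<beta> p N t) - real (\<beta> p N (t + 1)) else 0)" by simp
  qed
  also have "\<dots> = 2 * real p ^ N + (\<Sum>t<N. \<Sum>y\<in>carrier ?G. if s y \<le> t then real (\<beta> p N t) - real (\<beta> p N (t + 1)) else 0)"
    by (simp add: sum.distrib card sum.swap[of _ "carrier ?G"])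
  also have "(\<Sum>t<N. \<Sum>y\<in>carrier ?G. if s y \<le> t then real (\<beta> p N t) - real (\<beta> p N (t + 1)) else 0) = ?S"
  proof (intro sum.cong refl)
    fix t
    have "card {y \<in> carrier ?G. s y \<le> t} = p ^ column_boxes ks t"
      unfolding s_le_iff using p pos by (rule card_pairing_characters_torsion)
    then show "(\<Sum>y\<in>carrier ?G. if s y \<le> t then real (\<beta> p N t) - real (\<beta> p N (t + 1)) else 0) =
        real p ^ column_boxes ks t * (real (\<beta> p N t) - real (\<beta> p N (t + 1)))"
      using fin by (simp add: sum.If_cases Int_def)
  qed
  finally have "2 * real p ^ N * real ?W = 2 * real p ^ N + ?S" .
  moreover have "{..<N} = {0..N - 1}" using assms(2) by auto
  ultimately show ?thesis using p by (simp add: field_simps)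
qed

end
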